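(* Let $A,B$ be real symmetric $4\times 4$ matrices defining quadrics $\mathcal A: X^TAX=0$, $\mathcal B: X^TBX=0$ in $\mathbb{PR}^3$ with $f(\lambda)=\det(\lambda A-B)$ not identically zero. If $f(\lambda)=0$ has one quadruple root with Segre characteristic $[4]$, then the index sequence is $\langle 2\,{\wr\wr\wr\wr}_{-}\,2\rangle$ or its equivalent form $\langle 2\,{\wr\wr\wr\wr}_{+}\,2\rangle$, and in this case the QSIC comprises a real line and a real space cubic curve tangent to each other at a real point.
   Context: $X=(x,y,z,w)^T$ homogeneous coordinates; QSIC $=\mathcal A\cap\mathcal B$. One may take $A$ nonsingular. Canonical form: for $A$ nonsingular there is a real invertible $Q$ with $Q^TAQ=\mathrm{diag}(\varepsilon_1E_1,\dots)$, $Q^TBQ=\mathrm{diag}(\varepsilon_1E_1J_1,\dots)$, $J_i$ the real Jordan blocks of $A^{-1}B$, $E_i$ anti-identity matrices of matching sizes, and for blocks of real eigenvalues $\varepsilon_i\in\{\pm1\}$ uniquely determined (the sign of $J_i$). Segre characteristic $[4]$: a single eigenvalue with a single $4\times4$ Jordan block. $\mathrm{Id}(\lambda)$ = number of positive eigenvalues of $\lambda A-B$. Index sequence $\langle s_0\sigma_1s_1\rangle$ for one real root: $s_0,s_1$ are the values of $\mathrm{Id}$ before and after the root and $\sigma_1$ is four copies of $\wr$ with subscript the sign of the block. Equivalence of sequences is induced by change of basis of the pencil (including $(A,B)\mapsto(-A,-B)$, which sends $s\mapsto 4-s$ and reverses signs). *)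

theory Defs
  imports "HOL-Analysis.Analysis" "HOL-Computational_Algebra.Polynomial"
begin

section \<open>Quadric pencils in projective 3-space\<close>

type_synonym rmat = "real^4^4"
type_synonym rvec = "real^4"
type_synonym cvec = "complex^4"

definition symmetric4 :: "rmat \<Rightarrow> bool" where
  "symmetric4 M \<longleftrightarrow> transpose M = M"

text \<open>f(lambda) = det(lambda A - B)\<close>
definition pencil_det :: "rmat \<Rightarrow> rmat \<Rightarrow> real \<Rightarrow> real" where
  "pencil_det A B l = det (l *\<^sub>R A - B)"

text \<open>Real 4x4 Jordan block with eigenvalue l and anti-identity E_4.\<close>
definition jordan4 :: "real \<Rightarrow> rmat" where
  "jordan4 l = vector [vector [l,1,0,0], vector [0,l,1,0], vector [0,0,l,1], vector [0,0,0,l]]"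

definition antiid4 :: rmat where
  "antiid4 = vector [vector [0,0,0,1], vector [0,0,1,0], vector [0,1,0,0], vector [1,0,0,0]]"

text \<open>Segre characteristic [4] (A nonsingular): A^{-1}B has the single eigenvalue l
  with a single 4x4 Jordan block.\<close>
definition segre_4 :: "rmat \<Rightarrow> rmat \<Rightarrow> real \<Rightarrow> bool" where
  "segre_4 A B l \<longleftrightarrow> (\<exists>P. invertible P \<and> matrix_inv P ** (matrix_inv A ** B) ** P = jordan4 l)"

text \<open>Characteristic polynomial det(X I - M) and the number of positive eigenvalues
  (counted with algebraic multiplicity).\<close>
definition charpoly4 :: "rmat \<Rightarrow> real poly" where
  "charpoly4 M = det (\<chi> i j. (if i = j then [:0, 1:] else 0) - [:M $ i $ j:])"

definition num_pos_eig :: "rmat \<Rightarrow> nat" where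
  "num_pos_eig M = (\<Sum>r \<in> {r. r > 0 \<and> poly (charpoly4 M) r = 0}. order r (charpoly4 M))"

text \<open>Id(lambda) = number of positive eigenvalues of lambda A - B.\<close>
definition Id_fun :: "rmat \<Rightarrow> rmat \<Rightarrow> real \<Rightarrow> nat" where
  "Id_fun A B l = num_pos_eig (l *\<^sub>R A - B)"

text \<open>Sign of the Jordan block in the canonical form of the pencil (single block [4]):
  there is a real invertible Q with Q^T A Q = eps E_4 and Q^T B Q = eps E_4 J.\<close>
definition block_sign :: "rmat \<Rightarrow> rmat \<Rightarrow> real \<Rightarrow> real \<Rightarrow> bool" where
  "block_sign A B l eps \<longleftrightarrow> (\<exists>Q. invertible Q \<and>
      transpose Q ** A ** Q = eps *\<^sub>R antiid4 \<and>
      transpose Q ** B ** Q = eps *\<^sub>R (antiid4 ** jordan4 l))"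

section \<open>Complex points of the QSIC (as nonzero homogeneous coordinate vectors)\<close>

definition cvec_of :: "rvec \<Rightarrow> cvec" where
  "cvec_of v = (\<chi> i. complex_of_real (v $ i))"

definition cmat_of :: "rmat \<Rightarrow> complex^4^4" where
  "cmat_of M = (\<chi> i j. complex_of_real (M $ i $ j))"

definition qform :: "rmat \<Rightarrow> cvec \<Rightarrow> complex" where
  "qform M X = (\<Sum>i\<in>UNIV. \<Sum>j\<in>UNIV. X $ i * complex_of_real (M $ i $ j) * X $ j)"

text \<open>QSIC: the complex projective points X with X^T A X = 0 and X^T B X = 0.\<close>
definition QSIC :: "rmat \<Rightarrow> rmat \<Rightarrow> cvec set" where
  "QSIC A B = {X. X \<noteq> 0 \<and> qform A X = 0 \<and> qform B X = 0}"

text \<open>The (complex points of the) projective line through two points.\<close>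
definition proj_line :: "cvec \<Rightarrow> cvec \<Rightarrow> cvec set" where
  "proj_line u v = {X. X \<noteq> 0 \<and> (\<exists>a b. X = a *s u + b *s v)}"

text \<open>A real line: spanned by two linearly independent real points.\<close>
definition real_line :: "cvec set \<Rightarrow> bool" where
  "real_line L \<longleftrightarrow> (\<exists>p q :: rvec. p \<noteq> q \<and> independent {p, q}
                      \<and> L = proj_line (cvec_of p) (cvec_of q))"

text \<open>Twisted cubic parametrised by a real invertible matrix M:
  (s:t) maps to M (s^3, s^2 t, s t^2, t^3), and its partial derivatives.\<close>
definition cub :: "'a::comm_ring_1 \<Rightarrow> 'a \<Rightarrow> 'a^4" where
  "cub s t = vector [s^3, s^2 * t, s * t^2, t^3]"

definition cub_ds :: "'a::comm_ring_1 \<Rightarrow> 'a \<Rightarrow> 'a^4" where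
  "cub_ds s t = vector [3 * s^2, 2 * s * t, t^2, 0]"

definition cub_dt :: "'a::comm_ring_1 \<Rightarrow> 'a \<Rightarrow> 'a^4" where
  "cub_dt s t = vector [0, s^2, 2 * s * t, 3 * t^2]"

definition twisted_cubic :: "rmat \<Rightarrow> cvec set" where
  "twisted_cubic M = {X. \<exists>s t :: complex. (s, t) \<noteq> (0, 0) \<and> X = cmat_of M *v cub s t}"

text \<open>C is a real space cubic curve, and the line L is tangent to it at a real point:
  L is the tangent line of C at the real parameter (s0:t0).\<close>
definition real_cubic_tangent_line :: "cvec set \<Rightarrow> cvec set \<Rightarrow> bool" where
  "real_cubic_tangent_line C L \<longleftrightarrow> (\<exists>M :: rmat. invertible M \<and> C = twisted_cubic M \<and>
      (\<exists>s0 t0 :: real. (s0, t0) \<noteq> (0, 0) \<and>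
         L = proj_line (cvec_of (M *v cub_ds s0 t0)) (cvec_of (M *v cub_dt s0 t0))))"

end

theory Submission
  imports Defs
begin

text \<open>Since det (l A - B) = c (l - l0)^4 with c \<noteq> 0, the leading coefficient det A equals c,
  so A is nonsingular. If P is a Jordan basis of A^-1 B, the matrix H = P^T A P is symmetric and
  so is H J, which forces H to be a Hankel matrix vanishing above the anti-diagonal; a further
  change of basis by an upper triangular Toeplitz matrix, which commutes with J, brings the pencil
  to the canonical form (eps E, eps E J).

  In these coordinates the first basis vector is isotropic for every l A - B, and
  det (l A - B) > 0 for l \<noteq> l0. A nonsingular symmetric matrix with an isotropic vector has a
  negative eigenvalue, and so does its negative; the remaining two eigenvalues have negative
  product because the determinant is positive. Hence exactly two eigenvalues are positive.

  The canonical quadrics x w + y z = 0 and 2 y w + z^2 = 0 meet in the line z = w = 0 and in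
  the twisted cubic (s^3 : -s^2 t : 2 s t^2 : 2 t^3), whose tangent at (1 : 0) is that line.\<close>

lemma vector_4 [simp]:
  "(vector [x,y,z,w] :: 'a::zero^4)$1 = x"
  "(vector [x,y,z,w] :: 'a::zero^4)$2 = y"
  "(vector [x,y,z,w] :: 'a::zero^4)$3 = z"
  "(vector [x,y,z,w] :: 'a::zero^4)$4 = w"
  unfolding vector_def by simp_all

lemma vec_eq_4_iff: "(x::'a^4) = y \<longleftrightarrow> x$1 = y$1 \<and> x$2 = y$2 \<and> x$3 = y$3 \<and> x$4 = y$4"
  by (simp add: vec_eq_iff forall_4)

lemma det_4:
  "det (A::'a::comm_ring_1^4^4) =
    A$1$1 * A$2$2 * A$3$3 * A$4$4 - A$1$1 * A$2$2 * A$3$4 * A$4$3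
  - A$1$1 * A$2$3 * A$3$2 * A$4$4 + A$1$1 * A$2$3 * A$3$4 * A$4$2
  + A$1$1 * A$2$4 * A$3$2 * A$4$3 - A$1$1 * A$2$4 * A$3$3 * A$4$2
  - A$1$2 * A$2$1 * A$3$3 * A$4$4 + A$1$2 * A$2$1 * A$3$4 * A$4$3
  + A$1$2 * A$2$3 * A$3$1 * A$4$4 - A$1$2 * A$2$3 * A$3$4 * A$4$1
  - A$1$2 * A$2$4 * A$3$1 * A$4$3 + A$1$2 * A$2$4 * A$3$3 * A$4$1
  + A$1$3 * A$2$1 * A$3$2 * A$4$4 - A$1$3 * A$2$1 * A$3$4 * A$4$2
  - A$1$3 * A$2$2 * A$3$1 * A$4$4 + A$1$3 * A$2$2 * A$3$4 * A$4$1
  + A$1$3 * A$2$4 * A$3$1 * A$4$2 - A$1$3 * A$2$4 * A$3$2 * A$4$1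
  - A$1$4 * A$2$1 * A$3$2 * A$4$3 + A$1$4 * A$2$1 * A$3$3 * A$4$2
  + A$1$4 * A$2$2 * A$3$1 * A$4$3 - A$1$4 * A$2$2 * A$3$3 * A$4$1
  - A$1$4 * A$2$3 * A$3$1 * A$4$2 + A$1$4 * A$2$3 * A$3$2 * A$4$1"
proof -
  have f1: "finite {2::4, 3, 4}" "1 \<notin> {2::4, 3, 4}" by auto
  have f2: "finite {3::4, 4}" "2 \<notin> {3::4, 4}" by auto
  have f3: "finite {4::4}" "3 \<notin> {4::4}" by auto
  show ?thesis
    unfolding det_def UNIV_4
    unfolding sum_over_permutations_insert[OF f1] sum_over_permutations_insert[OF f2]
      sum_over_permutations_insert[OF f3] permutes_sing
    by (simp add: sign_swap_id permutation_swap_id sign_compose sign_id swap_id_eq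
        permutation_compose algebra_simps)
qed

lemma matrix_matrix_mult_4:
  "((X::'a::semiring_1^4^4) ** Y)$i$j =
    X$i$1 * Y$1$j + X$i$2 * Y$2$j + X$i$3 * Y$3$j + X$i$4 * Y$4$j"
  by (simp add: matrix_matrix_mult_def sum_4)

lemma matrix_vector_mult_4:
  "((X::'a::semiring_1^4^4) *v v)$i = X$i$1 * v$1 + X$i$2 * v$2 + X$i$3 * v$3 + X$i$4 * v$4"
  by (simp add: matrix_vector_mult_def sum_4)

lemma matrix_inv_right:
  assumes "invertible (A::'a::semiring_1^'n^'m)"
  shows "A ** matrix_inv A = mat 1"
  using someI_ex[OF assms[unfolded invertible_def]] by (simp add: matrix_inv_def)

lemma matrix_inv_left:
  assumes "invertible (A::'a::semiring_1^'n^'m)"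
  shows "matrix_inv A ** A = mat 1"
  using someI_ex[OF assms[unfolded invertible_def]] by (simp add: matrix_inv_def)

lemma matrix_diff_ldistrib: "(A::'a::ring_1^'n^'m) ** (B - C) = A ** B - A ** C"
  by (simp add: vec_eq_iff matrix_matrix_mult_def sum_subtractf algebra_simps)

lemma matrix_diff_rdistrib: "((B::'a::ring_1^'n^'m) - C) ** A = B ** A - C ** A"
  by (simp add: vec_eq_iff matrix_matrix_mult_def sum_subtractf algebra_simps)

lemma matrix_vector_mult_mat: "(mat k :: real^'n^'n) *v x = k *\<^sub>R x"
proof -
  have "mat k = k *\<^sub>R (mat 1 :: real^'n^'n)"
    by (simp add: vec_eq_iff mat_def)
  then show ?thesis
    by (simp flip: scaleR_matrix_vector_assoc)
qed

lemma det_scaleR: "det (k *\<^sub>R A) = k ^ CARD('n) * det (A::real^'n^'n)"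
proof -
  have "k *\<^sub>R A = (\<chi> i. k *s A $ i)"
    by (simp add: vec_eq_iff scalar_mult_eq_scaleR)
  then show ?thesis
    using det_rows_mul[of "\<lambda>_. k" "\<lambda>i. A $ i"] by simp
qed

lemma inner_congruence:
  fixes Q M :: "real^'n^'n"
  shows "(Q *v x) \<bullet> (M *v (Q *v y)) = x \<bullet> ((transpose Q ** M ** Q) *v y)"
proof -
  have "(Q *v x) \<bullet> (M *v (Q *v y)) = (x v* transpose Q) \<bullet> (M *v (Q *v y))"
    by simp
  also have "\<dots> = x \<bullet> (transpose Q *v (M *v (Q *v y)))"
    by (rule dot_lmul_matrix)
  also have "\<dots> = x \<bullet> ((transpose Q ** M ** Q) *v y)"
    by (simp add: matrix_vector_mul_assoc matrix_mul_assoc)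
  finally show ?thesis .
qed

lemma det_eq_leading_coeff_pencil:
  fixes A B :: "real^'n^'n"
  assumes pencil: "\<And>l. det (l *\<^sub>R A - B) = c * (l - l0) ^ CARD('n)"
  shows "det A = c"
proof -
  define g where "g t = det (A - t *\<^sub>R B)" for t
  define f where "f t = c * (1 - t * l0) ^ CARD('n)" for t
  have "g t = f t" if "t \<noteq> 0" for t
  proof -
    have "A - t *\<^sub>R B = t *\<^sub>R ((1/t) *\<^sub>R A - B)"
      using that by (simp add: algebra_simps)
    then have "g t = t ^ CARD('n) * (c * (1/t - l0) ^ CARD('n))"
      unfolding g_def by (simp add: det_scaleR pencil)
    also have "\<dots> = f t"
      unfolding f_def using that by (simp add: power_mult_distrib[symmetric] algebra_simps)
    finally show ?thesis .
  qed
  then have "eventually (\<lambda>t. f t = g t) (at 0)"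
    by (auto simp: eventually_at_filter)
  moreover have "(f \<longlongrightarrow> f 0) (at 0)"
    unfolding f_def by (intro tendsto_intros)
  ultimately have "(g \<longlongrightarrow> f 0) (at 0)"
    by (simp add: tendsto_cong)
  moreover have "(g \<longlongrightarrow> g 0) (at 0)"
    unfolding g_def det_def by (intro tendsto_intros)
  ultimately have "g 0 = f 0"
    using LIM_unique by blast
  then show ?thesis
    unfolding g_def f_def by simp
qed

section \<open>Canonical form of a pencil with Segre characteristic [4]\<close>

definition hankel4 :: "real \<Rightarrow> real \<Rightarrow> real \<Rightarrow> real \<Rightarrow> real^4^4" where
  "hankel4 a b c d =
     vector [vector [0,0,0,a], vector [0,0,a,b], vector [0,a,b,c], vector [a,b,c,d]]"

definition toeplitz4 :: "real \<Rightarrow> real \<Rightarrow> real \<Rightarrow> real \<Rightarrow> real^4^4" where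
  "toeplitz4 a b c d =
     vector [vector [a,b,c,d], vector [0,a,b,c], vector [0,0,a,b], vector [0,0,0,a]]"

lemma hankel4_if_symmetric_times_jordan4:
  fixes H :: "real^4^4"
  assumes "transpose H = H" and "transpose (H ** jordan4 l) = H ** jordan4 l"
  shows "H = hankel4 (H$1$4) (H$2$4) (H$3$4) (H$4$4)"
proof -
  have sym: "M$j$i = M$i$j" if "transpose M = M" for M :: "real^4^4" and i j
    using arg_cong[OF that, of "\<lambda>M. M$i$j"] by (simp add: transpose_def)
  note HJ = sym[OF assms(2)]
  have H: "H$2$1 = H$1$2" "H$3$1 = H$1$3" "H$4$1 = H$1$4" "H$3$2 = H$2$3" "H$4$2 = H$2$4"
    "H$4$3 = H$3$4"
    by (rule sym[OF assms(1)])+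
  have upper: "H$1$1 = 0" "H$1$2 = 0" "H$1$3 = 0" "H$2$3 = H$1$4" "H$3$3 = H$2$4"
    using HJ[of 1 2] HJ[of 1 3] HJ[of 1 4] HJ[of 2 4] HJ[of 3 4] H
    by (simp_all add: matrix_matrix_mult_4 jordan4_def)
  moreover have "H$2$2 = 0"
    using HJ[of 2 3] H upper by (simp add: matrix_matrix_mult_4 jordan4_def)
  ultimately show ?thesis
    by (simp add: vec_eq_4_iff hankel4_def H)
qed

lemma toeplitz4_jordan4_commute:
  "toeplitz4 q0 q1 q2 q3 ** jordan4 l = jordan4 l ** toeplitz4 q0 q1 q2 q3"
  unfolding vec_eq_4_iff
  by (intro conjI; simp add: matrix_matrix_mult_4 toeplitz4_def jordan4_def algebra_simps)

lemma toeplitz4_hankel4_congruence: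
  "transpose (toeplitz4 q0 q1 q2 q3) ** hankel4 a b c d ** toeplitz4 q0 q1 q2 q3 =
   hankel4 (q0^2*a) (2*q0*q1*a + q0^2*b) ((q1^2 + 2*q0*q2)*a + 2*q0*q1*b + q0^2*c)
     ((2*q0*q3 + 2*q1*q2)*a + (q1^2 + 2*q0*q2)*b + 2*q0*q1*c + q0^2*d)"
  unfolding vec_eq_4_iff
  by (intro conjI; simp add: matrix_matrix_mult_4 transpose_def toeplitz4_def hankel4_def
      power2_eq_square algebra_simps)

lemma det_toeplitz4: "det (toeplitz4 q0 q1 q2 q3) = q0^4"
  unfolding toeplitz4_def det_4 by (simp add: power4_eq_xxxx)

lemma det_hankel4: "det (hankel4 a b c d) = a^4"
  unfolding hankel4_def det_4 by (simp add: power4_eq_xxxx)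

lemma hankel4_congruent_antiid4:
  assumes "a \<noteq> 0"
  obtains T eps where "invertible T" "eps = -1 \<or> eps = 1"
    "T ** jordan4 l = jordan4 l ** T"
    "transpose T ** hankel4 a b c d ** T = eps *\<^sub>R antiid4"
proof -
  define eps :: real where "eps = sgn a"
  \<comment> \<open>q1, q2, q3 clear the entries below the anti-diagonal one after the other\<close>
  define q0 where "q0 = 1 / sqrt \<bar>a\<bar>"
  define q1 where "q1 = - q0 * b / (2 * a)"
  define q2 where "q2 = - (q1^2 * a + 2*q0*q1*b + q0^2*c) / (2 * q0 * a)"
  define q3 where "q3 = - (2*q1*q2*a + (q1^2 + 2*q0*q2)*b + 2*q0*q1*c + q0^2*d) / (2 * q0 * a)"
  have q0: "q0 \<noteq> 0" "q0^2 * a = eps"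
    using assms by (auto simp: q0_def eps_def power_divide sgn_if)
  have "transpose (toeplitz4 q0 q1 q2 q3) ** hankel4 a b c d ** toeplitz4 q0 q1 q2 q3
        = hankel4 eps 0 0 0"
    unfolding toeplitz4_hankel4_congruence q0(2)
    using assms q0(1) by (simp add: q1_def q2_def q3_def field_simps power2_eq_square)
  also have "\<dots> = eps *\<^sub>R antiid4"
    unfolding vec_eq_4_iff by (simp add: hankel4_def antiid4_def)
  finally show thesis
    using that[of "toeplitz4 q0 q1 q2 q3" eps] q0(1) assms
    by (auto simp: invertible_det_nz det_toeplitz4 toeplitz4_jordan4_commute eps_def sgn_if)
qed

lemma segre_4_block_sign:
  fixes A B :: "real^4^4"
  assumes "symmetric4 A" "symmetric4 B" "invertible A" and "segre_4 A B l"
  shows "\<exists>eps. (eps = -1 \<or> eps = 1) \<and> block_sign A B l eps"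
proof -
  obtain P where P: "invertible P" and PJ: "matrix_inv P ** (matrix_inv A ** B) ** P = jordan4 l"
    using \<open>segre_4 A B l\<close> unfolding segre_4_def by blast
  have "A ** P ** jordan4 l = A ** (P ** matrix_inv P) ** (matrix_inv A ** B) ** P"
    by (simp add: PJ[symmetric] matrix_mul_assoc)
  also have "\<dots> = B ** P"
    by (simp add: matrix_mul_assoc matrix_inv_right[OF P] matrix_inv_right[OF \<open>invertible A\<close>])
  finally have BP: "B ** P = A ** P ** jordan4 l" ..
  define H where "H = transpose P ** A ** P"
  have HB: "transpose P ** B ** P = H ** jordan4 l"
    unfolding H_def by (simp add: BP flip: matrix_mul_assoc)
  have "transpose H = H"
    using assms(1) unfolding H_def symmetric4_def
    by (simp add: matrix_transpose_mul matrix_mul_assoc)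
  moreover have "transpose (H ** jordan4 l) = H ** jordan4 l"
    using assms(2) unfolding HB[symmetric] symmetric4_def
    by (simp add: matrix_transpose_mul matrix_mul_assoc)
  ultimately have H: "H = hankel4 (H$1$4) (H$2$4) (H$3$4) (H$4$4)"
    by (rule hankel4_if_symmetric_times_jordan4)
  have "det H \<noteq> 0"
    using P assms(3) by (simp add: H_def det_mul invertible_det_nz)
  then have "H$1$4 \<noteq> 0"
    by (subst (asm) H) (simp add: det_hankel4)
  then obtain T eps where T: "invertible T" "eps = -1 \<or> eps = 1"
      "T ** jordan4 l = jordan4 l ** T" and THT: "transpose T ** H ** T = eps *\<^sub>R antiid4"
    using hankel4_congruent_antiid4 H by metis
  define Q where "Q = P ** T"
  have QA: "transpose Q ** A ** Q = eps *\<^sub>R antiid4"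
    unfolding Q_def THT[symmetric] H_def by (simp add: matrix_transpose_mul matrix_mul_assoc)
  have "transpose Q ** B ** Q = transpose T ** (transpose P ** B ** P) ** T"
    unfolding Q_def by (simp add: matrix_transpose_mul matrix_mul_assoc)
  also have "\<dots> = transpose T ** H ** (jordan4 l ** T)"
    by (simp add: HB matrix_mul_assoc)
  also have "\<dots> = transpose T ** H ** T ** jordan4 l"
    by (simp add: T(3)[symmetric] matrix_mul_assoc)
  also have "\<dots> = eps *\<^sub>R (antiid4 ** jordan4 l)"
    by (simp add: THT flip: scalar_matrix_assoc)
  finally show ?thesis
    unfolding block_sign_def using QA T(2) invertible_mult[OF P T(1)] Q_def by blast
qed

section \<open>The index sequence\<close>

lemma nonneg_quadratic_imp_linear_coeff_zero:
  fixes a c :: real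
  assumes "\<And>s. 0 \<le> 2 * s * a + s^2 * c"
  shows "a = 0"
proof (rule ccontr)
  assume "a \<noteq> 0"
  define k where "k = \<bar>c\<bar> + 1"
  have "k > 0" "c - 2 * k < 0"
    unfolding k_def by auto
  have "2 * (- a / k) * a + (- a / k)^2 * c = a^2 * (c - 2 * k) / k^2"
    using \<open>k > 0\<close> by (simp add: field_simps power2_eq_square)
  also have "\<dots> < 0"
    using \<open>a \<noteq> 0\<close> \<open>k > 0\<close> \<open>c - 2 * k < 0\<close> by (simp add: divide_neg_pos mult_pos_neg)
  finally show False
    using assms[of "- a / k"] by simp
qed

lemma symmetric_matrix_inner_commute:
  fixes M :: "real^'n^'n"
  assumes "transpose M = M"
  shows "x \<bullet> (M *v y) = y \<bullet> (M *v x)"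
  by (metis assms dot_lmul_matrix inner_commute transpose_matrix_vector)

lemma psd_isotropic_vector_in_kernel:
  fixes K :: "real^'n^'n"
  assumes "transpose K = K" and psd: "\<And>w. 0 \<le> w \<bullet> (K *v w)" and "u \<bullet> (K *v u) = 0"
  shows "K *v u = 0"
proof -
  have "w \<bullet> (K *v u) = 0" for w
  proof (rule nonneg_quadratic_imp_linear_coeff_zero)
    fix s :: real
    have "0 \<le> (u + s *\<^sub>R w) \<bullet> (K *v (u + s *\<^sub>R w))"
      by (rule psd)
    also have "\<dots> = 2 * s * (w \<bullet> (K *v u)) + s^2 * (w \<bullet> (K *v w))"
      using assms(3) symmetric_matrix_inner_commute[OF assms(1), of u w]
      by (simp add: algebra_simps inner_add_left inner_add_right power2_eq_square)
    finally show "0 \<le> 2 * s * (w \<bullet> (K *v u)) + s^2 * (w \<bullet> (K *v w))" .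
  qed
  from this[of "K *v u"] show ?thesis
    by simp
qed

lemma symmetric_matrix_least_eigenvalue:
  fixes M :: "real^'n^'n"
  assumes sym: "transpose M = M"
  obtains mu u where "u \<noteq> 0" "M *v u = mu *\<^sub>R u" "\<And>w. mu * (w \<bullet> w) \<le> w \<bullet> (M *v w)"
proof -
  define f where "f x = x \<bullet> (M *v x)" for x :: "real^'n"
  have cont: "continuous_on (sphere 0 1) f"
    unfolding f_def
    by (intro continuous_intros bounded_linear.continuous_on[OF matrix_vector_mul_bounded_linear])
  obtain u where u: "u \<in> sphere 0 1" and umin: "\<And>y. y \<in> sphere 0 1 \<Longrightarrow> f u \<le> f y"
    using continuous_attains_inf[OF compact_sphere _ cont] by force
  define mu where "mu = f u"
  have f_scale: "f (c *\<^sub>R w) = c^2 * f w" for c w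
    unfolding f_def by (simp add: matrix_vector_mult_scaleR power2_eq_square)
  have least: "mu * (w \<bullet> w) \<le> f w" for w
  proof (cases "w = 0")
    case False
    then have "mu \<le> f ((1 / norm w) *\<^sub>R w)"
      unfolding mu_def by (intro umin) simp
    also have "\<dots> = f w / (norm w)^2"
      by (simp add: f_scale power_one_over)
    finally show ?thesis
      using False by (simp add: field_simps dot_square_norm)
  qed (simp add: f_def)
  define K where "K = M - mu *\<^sub>R mat 1"
  have K: "w \<bullet> (K *v w) = f w - mu * (w \<bullet> w)" for w
    by (simp add: K_def f_def matrix_vector_mult_diff_rdistrib inner_diff_right
        flip: scaleR_matrix_vector_assoc)
  have "K *v u = 0"
  proof (rule psd_isotropic_vector_in_kernel)
    show "transpose K = K"
      using sym by (simp add: K_def transpose_def vec_eq_iff mat_def)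
    show "0 \<le> w \<bullet> (K *v w)" for w
      using least[of w] by (simp add: K)
    show "u \<bullet> (K *v u) = 0"
      using u by (simp add: K mu_def dot_square_norm)
  qed
  then have "M *v u = mu *\<^sub>R u"
    by (simp add: K_def matrix_vector_mult_diff_rdistrib flip: scaleR_matrix_vector_assoc)
  moreover have "u \<noteq> 0"
    using u by auto
  ultimately show thesis
    using that least unfolding f_def by blast
qed

lemma symmetric_matrix_negative_eigenvalue:
  fixes M :: "real^'n^'n"
  assumes "transpose M = M" "det M \<noteq> 0" "v \<noteq> 0" "v \<bullet> (M *v v) \<le> 0"
  obtains m u where "m < 0" "u \<noteq> 0" "M *v u = m *\<^sub>R u"
proof -
  obtain mu u where u: "u \<noteq> 0" "M *v u = mu *\<^sub>R u"
    and least: "\<And>w. mu * (w \<bullet> w) \<le> w \<bullet> (M *v w)"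
    using symmetric_matrix_least_eigenvalue[OF assms(1)] by blast
  have "mu * (v \<bullet> v) \<le> 0" "v \<bullet> v > 0"
    using least[of v] assms(3,4) by auto
  then have "mu \<le> 0"
    by (simp add: mult_le_0_iff)
  moreover have "mu \<noteq> 0"
  proof
    assume "mu = 0"
    then have "M *v u = M *v 0"
      using u by simp
    then show False
      using u(1) assms(2) inj_matrix_vector_mult invertible_det_nz by (metis injD)
  qed
  ultimately show thesis
    using that u by force
qed

lemma poly_charpoly4: "poly (charpoly4 M) x = det (mat x - M)"
  unfolding charpoly4_def det_4 by (simp add: mat_def) algebra

lemma charpoly4_coeffs: "\<exists>c1 c2 c3. charpoly4 M = [:det M, c1, c2, c3, 1:]"
proof -
  define m2 where "m2 i j = M$i$i * M$j$j - M$i$j * M$j$i" for i j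
  define m3 where "m3 i j k = M$i$i * m2 j k - M$i$j * (M$j$i * M$k$k - M$j$k * M$k$i)
    + M$i$k * (M$j$i * M$k$j - M$j$j * M$k$i)" for i j k
  define c1 where "c1 = - (m3 1 2 3 + m3 1 2 4 + m3 1 3 4 + m3 2 3 4)"
  define c2 where "c2 = m2 1 2 + m2 1 3 + m2 1 4 + m2 2 3 + m2 2 4 + m2 3 4"
  have "poly (charpoly4 M) x = poly [:det M, c1, c2, - trace M, 1:] x" for x
    unfolding poly_charpoly4 det_4 c1_def c2_def m3_def m2_def
    by (simp add: mat_def trace_def sum_4) algebra
  then have "charpoly4 M = [:det M, c1, c2, - trace M, 1:]"
    using poly_eq_poly_eq_iff by blast
  then show ?thesis
    by blast
qed

lemma charpoly4_eigenvalue_root: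
  fixes M :: "real^4^4"
  assumes "u \<noteq> 0" "M *v u = m *\<^sub>R u"
  shows "poly (charpoly4 M) m = 0"
proof -
  have "(mat m - M) *v u = (mat m - M) *v 0"
    using assms(2) by (simp add: matrix_vector_mult_diff_rdistrib matrix_vector_mult_mat)
  then have "\<not> invertible (mat m - M)"
    using assms(1) inj_matrix_vector_mult by (metis injD)
  then show ?thesis
    by (simp add: poly_charpoly4 invertible_det_nz)
qed

lemma monic_quadratic_roots_of_negative_constant:
  fixes q :: "real poly"
  assumes "degree q = 2" "lead_coeff q = 1" "poly q 0 < 0"
  obtains r1 r2 where "r1 > 0" "r2 < 0" "q = [:-r1, 1:] * [:-r2, 1:]"
proof -
  define b where "b = coeff q 1"
  define e where "e = coeff q 0"
  have q: "q = [:e, b, 1:]"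
    using assms(1,2) unfolding b_def e_def
    by (intro poly_eqI) (auto simp: coeff_pCons numeral_2_eq_2 coeff_eq_0 split: nat.split)
  then have "e < 0"
    using assms(3) by simp
  define s where "s = sqrt (b^2 - 4*e)"
  have "0 \<le> b^2 - 4*e"
    using \<open>e < 0\<close> zero_le_power2[of b] by linarith
  then have s2: "s^2 = b^2 - 4*e"
    unfolding s_def by simp
  have "\<bar>b\<bar> < s"
    unfolding s_def using \<open>e < 0\<close> real_sqrt_less_mono[of "b^2" "b^2 - 4*e"] by simp
  then have "(- b + s) / 2 > 0" "(- b - s) / 2 < 0"
    by auto
  moreover have "q = [:- ((- b + s) / 2), 1:] * [:- ((- b - s) / 2), 1:]"
    unfolding q using s2 by (simp add: field_simps power2_eq_square)
  ultimately show thesis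
    using that by blast
qed

lemma order_linear_factor: "order r [:-a, 1::real:] = (if r = a then 1 else 0)"
  using order_power_n_n[of a 1] by (auto intro: order_0I)

lemma monic_quartic_two_positive_roots:
  fixes p :: "real poly"
  assumes "degree p = 4" "lead_coeff p = 1" "poly p 0 > 0"
    and "poly p m = 0" "m < 0" and "poly p u = 0" "u > 0"
  shows "(\<Sum>r\<in>{r. r > 0 \<and> poly p r = 0}. order r p) = 2"
proof -
  obtain p1 where p1: "p = [:-m, 1:] * p1"
    using assms(4) poly_eq_0_iff_dvd by (metis dvdE)
  then have "poly p1 u = 0"
    using assms(5-7) by simp
  then obtain q where "p1 = [:-u, 1:] * q"
    using poly_eq_0_iff_dvd by (metis dvdE)
  with p1 have pq: "p = [:-m, 1:] * [:-u, 1:] * q"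
    by (metis mult.assoc)
  then have "q \<noteq> 0"
    using assms(1) by auto
  then have "degree q = 2"
    using assms(1) unfolding pq by (simp add: degree_mult_eq del: mult_pCons_left mult_pCons_right)
  moreover have "lead_coeff q = 1"
    using assms(2) \<open>degree q = 2\<close> unfolding pq
    by (simp add: lead_coeff_mult del: mult_pCons_left mult_pCons_right)
  moreover have "poly q 0 < 0"
  proof -
    have "0 < m * u * poly q 0"
      using assms(3) unfolding pq by (simp add: mult.commute)
    then show ?thesis
      using assms(5,7) by (auto simp: zero_less_mult_iff)
  qed
  ultimately obtain r1 r2 where r: "r1 > 0" "r2 < 0" "q = [:-r1, 1:] * [:-r2, 1:]"
    by (rule monic_quadratic_roots_of_negative_constant)
  have p: "p = [:-m, 1:] * [:-u, 1:] * [:-r1, 1:] * [:-r2, 1:]"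
    unfolding pq r(3) by (simp only: mult.assoc)
  have order: "order r p = (if r = m then 1 else 0) + (if r = u then 1 else 0)
      + (if r = r1 then 1 else 0) + (if r = r2 then 1 else 0)" for r
    unfolding p by (simp add: order_mult order_linear_factor del: mult_pCons_left mult_pCons_right)
  have "{r. r > 0 \<and> poly p r = 0} = {u, r1}"
    using assms(5,7) r(1,2) unfolding p by (auto simp del: mult_pCons_left mult_pCons_right)
  then show ?thesis
    using assms(5,7) r(1,2) by (cases "u = r1") (simp_all add: order)
qed

lemma num_pos_eig_isotropic:
  fixes M :: "real^4^4"
  assumes sym: "transpose M = M" and "det M > 0" and "v \<noteq> 0" "v \<bullet> (M *v v) = 0"
  shows "num_pos_eig M = 2"
proof -
  obtain m u where m: "m < 0" "u \<noteq> 0" "M *v u = m *\<^sub>R u"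
    using symmetric_matrix_negative_eigenvalue[OF sym _ assms(3)] assms(2,4) by auto
  have "transpose (- M) = - M"
    using sym by (simp add: transpose_def vec_eq_iff)
  moreover have "det (- M) \<noteq> 0"
    using det_scaleR[of "- 1" M] assms(2) by simp
  moreover have "v \<bullet> ((- M) *v v) \<le> 0"
    using assms(4) scaleR_matrix_vector_assoc[of "- 1" M v, symmetric] by simp
  ultimately obtain m' u' where m': "m' < 0" "u' \<noteq> 0" "(- M) *v u' = m' *\<^sub>R u'"
    using symmetric_matrix_negative_eigenvalue assms(3) by blast
  have "- (M *v u') = m' *\<^sub>R u'"
    using m'(3) scaleR_matrix_vector_assoc[of "- 1" M u', symmetric] by simp
  then have M_u': "M *v u' = (- m') *\<^sub>R u'"
    by (metis minus_minus scaleR_minus_left)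
  obtain c1 c2 c3 where p: "charpoly4 M = [:det M, c1, c2, c3, 1:]"
    using charpoly4_coeffs by blast
  show ?thesis
    unfolding num_pos_eig_def
  proof (rule monic_quartic_two_positive_roots)
    show "degree (charpoly4 M) = 4" "lead_coeff (charpoly4 M) = 1" "poly (charpoly4 M) 0 > 0"
      using \<open>det M > 0\<close> unfolding p by simp_all
    show "poly (charpoly4 M) m = 0"
      by (rule charpoly4_eigenvalue_root[OF m(2,3)])
    show "poly (charpoly4 M) (- m') = 0"
      by (rule charpoly4_eigenvalue_root[OF m'(2) M_u'])
  qed (use m m' in auto)
qed

lemma det_antiid4: "det antiid4 = 1"
  unfolding antiid4_def det_4 by simp

lemma block_sign_det_pos:
  assumes "block_sign A B l eps" "eps = -1 \<or> eps = 1"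
  shows "det A > 0"
proof -
  obtain Q where "transpose Q ** A ** Q = eps *\<^sub>R antiid4"
    using assms(1) unfolding block_sign_def by blast
  then have "det (transpose Q ** A ** Q) = det (eps *\<^sub>R antiid4)"
    by (rule arg_cong)
  then have "det Q * det A * det Q = eps ^ 4"
    by (simp add: det_mul det_scaleR det_antiid4)
  then have "0 < det A * (det Q)^2"
    using assms(2) by (auto simp: power2_eq_square mult_ac)
  then show ?thesis
    by (auto simp: zero_less_mult_iff)
qed

lemma Id_fun_off_root:
  fixes A B :: "real^4^4"
  assumes "symmetric4 A" "symmetric4 B" and "block_sign A B l0 eps" "eps = -1 \<or> eps = 1"
    and pencil: "\<And>l. pencil_det A B l = det A * (l - l0)^4" and "l \<noteq> l0"
  shows "Id_fun A B l = 2"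
proof -
  obtain Q where Q: "invertible Q" and QA: "transpose Q ** A ** Q = eps *\<^sub>R antiid4"
    and QB: "transpose Q ** B ** Q = eps *\<^sub>R (antiid4 ** jordan4 l0)"
    using assms(3) unfolding block_sign_def by blast
  define M where "M = l *\<^sub>R A - B"
  have "transpose M = M"
    using assms(1,2) by (simp add: M_def symmetric4_def transpose_def vec_eq_iff)
  moreover have "det M > 0"
    using pencil[of l] block_sign_det_pos[OF assms(3,4)] \<open>l \<noteq> l0\<close>
    by (simp add: M_def pencil_det_def)
  moreover have "Q *v axis 1 1 \<noteq> 0"
    using inj_matrix_vector_mult[OF Q] by (metis axis_eq_0_iff injD matrix_vector_mult_0_right
        zero_neq_one)
  moreover have "(Q *v axis 1 1) \<bullet> (M *v (Q *v axis 1 1)) = 0"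
  proof -
    have "transpose Q ** M ** Q = l *\<^sub>R (eps *\<^sub>R antiid4) - eps *\<^sub>R (antiid4 ** jordan4 l0)"
      unfolding M_def QA[symmetric] QB[symmetric]
      by (simp add: matrix_diff_ldistrib matrix_diff_rdistrib matrix_scalar_ac
          scalar_matrix_assoc matrix_mul_assoc)
    then show ?thesis
      unfolding inner_congruence
      by (simp add: matrix_vector_mult_basis inner_axis' column_def matrix_matrix_mult_4
          antiid4_def jordan4_def)
  qed
  ultimately show ?thesis
    unfolding Id_fun_def M_def[symmetric] by (rule num_pos_eig_isotropic)
qed

section \<open>The intersection curve\<close>

lemma cvec_of_matrix_vector_mult: "cvec_of (A *v x) = cmat_of A *v cvec_of x"
  by (simp add: vec_eq_iff cvec_of_def cmat_of_def matrix_vector_mult_def)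

lemma cmat_of_matrix_matrix_mult: "cmat_of (A ** B) = cmat_of A ** cmat_of B"
  by (simp add: vec_eq_iff cmat_of_def matrix_matrix_mult_def)

lemma cmat_of_mat_1: "cmat_of (mat 1) = mat 1"
  by (simp add: vec_eq_iff cmat_of_def mat_def)

lemma invertible_cmat_of:
  assumes "invertible Q"
  shows "invertible (cmat_of Q)"
  unfolding invertible_def
  by (metis assms cmat_of_mat_1 cmat_of_matrix_matrix_mult matrix_inv_left matrix_inv_right)

lemma sum_matrix_vector_mult_transpose:
  fixes P :: "'a::comm_semiring_1^'n^'m"
  shows "(\<Sum>i\<in>UNIV. (P *v x) $ i * y $ i) = (\<Sum>j\<in>UNIV. x $ j * (transpose P *v y) $ j)"
  by (simp add: matrix_vector_mult_def transpose_def sum_distrib_left sum_distrib_right mult_ac)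
    (rule sum.swap)

text \<open>qform is the complex-bilinear, not the Hermitian, extension of the real form, so
  a change of coordinates acts through the transpose.\<close>
lemma qform_eq_sum: "qform M X = (\<Sum>i\<in>UNIV. X $ i * (cmat_of M *v X) $ i)"
  by (simp add: qform_def cmat_of_def matrix_vector_mult_def sum_distrib_left mult.assoc)

lemma qform_cmat_of_mult: "qform A (cmat_of Q *v Y) = qform (transpose Q ** A ** Q) Y"
proof -
  have "cmat_of (transpose Q) = transpose (cmat_of Q)"
    by (simp add: vec_eq_iff cmat_of_def transpose_def)
  then show ?thesis
    unfolding qform_eq_sum
    using sum_matrix_vector_mult_transpose[of "cmat_of Q" Y "cmat_of A *v (cmat_of Q *v Y)"]
    by (simp add: mult.commute cmat_of_matrix_matrix_mult matrix_vector_mul_assoc matrix_mul_assoc)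
qed

lemma QSIC_congruence:
  assumes "invertible Q"
  shows "QSIC A B = (*v) (cmat_of Q) ` QSIC (transpose Q ** A ** Q) (transpose Q ** B ** Q)"
proof -
  have inj: "inj ((*v) (cmat_of Q))"
    by (rule inj_matrix_vector_mult[OF invertible_cmat_of[OF assms]])
  have X: "X = cmat_of Q *v (cmat_of (matrix_inv Q) *v X)" for X
    by (simp add: matrix_vector_mul_assoc matrix_inv_right[OF assms] cmat_of_mat_1
        flip: cmat_of_matrix_matrix_mult)
  show ?thesis
  proof (intro equalityI subsetI)
    fix X
    assume "X \<in> QSIC A B"
    moreover define Y where "Y = cmat_of (matrix_inv Q) *v X"
    ultimately have "Y \<in> QSIC (transpose Q ** A ** Q) (transpose Q ** B ** Q)"
      using X[of X] by (auto simp: QSIC_def qform_cmat_of_mult simp flip: Y_def)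
    then show "X \<in> (*v) (cmat_of Q) ` QSIC (transpose Q ** A ** Q) (transpose Q ** B ** Q)"
      using X[of X] Y_def by blast
  next
    fix X
    assume "X \<in> (*v) (cmat_of Q) ` QSIC (transpose Q ** A ** Q) (transpose Q ** B ** Q)"
    then obtain Y where "Y \<in> QSIC (transpose Q ** A ** Q) (transpose Q ** B ** Q)"
      and "X = cmat_of Q *v Y"
      by blast
    then show "X \<in> QSIC A B"
      using inj by (auto simp: QSIC_def qform_cmat_of_mult dest: injD[of _ _ 0])
  qed
qed

lemma proj_line_image:
  fixes M :: "complex^4^4"
  assumes "inj ((*v) M)"
  shows "(*v) M ` proj_line u v = proj_line (M *v u) (M *v v)"
proof -
  have lin: "M *v (a *s u + b *s v) = a *s (M *v u) + b *s (M *v v)" for a b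
    by (simp add: vec_eq_iff matrix_vector_mult_def sum_distrib_left sum.distrib algebra_simps)
  have zero: "M *v X = 0 \<longleftrightarrow> X = 0" for X
    using assms by (metis injD matrix_vector_mult_0_right)
  show ?thesis
    unfolding proj_line_def using lin zero by (auto simp: image_iff) metis
qed

lemma twisted_cubic_image: "(*v) (cmat_of Q) ` twisted_cubic M = twisted_cubic (Q ** M)"
  unfolding twisted_cubic_def cmat_of_matrix_matrix_mult matrix_vector_mul_assoc[symmetric]
  by blast

lemma real_line_image:
  assumes "invertible Q" "real_line L"
  shows "real_line ((*v) (cmat_of Q) ` L)"
proof -
  obtain p q where pq: "p \<noteq> q" "independent {p, q}" and L: "L = proj_line (cvec_of p) (cvec_of q)"
    using assms(2) unfolding real_line_def by blast
  have inj: "inj ((*v) Q)"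
    by (rule inj_matrix_vector_mult[OF assms(1)])
  have "independent ((*v) Q ` {p, q})"
    using pq(2) inj by (intro linear_independent_injective_image matrix_vector_mul_linear)
      (auto intro: inj_on_subset)
  moreover have "Q *v p \<noteq> Q *v q"
    using pq(1) inj by (auto dest: injD)
  moreover have "(*v) (cmat_of Q) ` L = proj_line (cvec_of (Q *v p)) (cvec_of (Q *v q))"
    unfolding L cvec_of_matrix_vector_mult
    by (rule proj_line_image[OF inj_matrix_vector_mult[OF invertible_cmat_of[OF assms(1)]]])
  ultimately show ?thesis
    unfolding real_line_def by auto
qed

lemma real_cubic_tangent_line_image:
  assumes "invertible Q" "real_cubic_tangent_line C L"
  shows "real_cubic_tangent_line ((*v) (cmat_of Q) ` C) ((*v) (cmat_of Q) ` L)"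
proof -
  obtain M s0 t0 where M: "invertible M" "C = twisted_cubic M" "(s0, t0) \<noteq> (0, 0)"
    and L: "L = proj_line (cvec_of (M *v cub_ds s0 t0)) (cvec_of (M *v cub_dt s0 t0))"
    using assms(2) unfolding real_cubic_tangent_line_def by blast
  have "(*v) (cmat_of Q) ` L
      = proj_line (cvec_of (Q *v (M *v cub_ds s0 t0))) (cvec_of (Q *v (M *v cub_dt s0 t0)))"
    unfolding L cvec_of_matrix_vector_mult[of Q]
    by (rule proj_line_image[OF inj_matrix_vector_mult[OF invertible_cmat_of[OF assms(1)]]])
  then have "(*v) (cmat_of Q) ` L
      = proj_line (cvec_of ((Q ** M) *v cub_ds s0 t0)) (cvec_of ((Q ** M) *v cub_dt s0 t0))"
    by (simp only: matrix_vector_mul_assoc)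
  moreover have "(*v) (cmat_of Q) ` C = twisted_cubic (Q ** M)"
    unfolding M(2) by (rule twisted_cubic_image)
  moreover have "invertible (Q ** M)"
    using invertible_mult[OF assms(1) M(1)] .
  ultimately show ?thesis
    unfolding real_cubic_tangent_line_def using M(3) by blast
qed

text \<open>The standard twisted cubic (s^3, s^2 t, s t^2, t^3), rescaled so that it lies on the
  canonical quadrics x w + y z = 0 and 2 y w + z^2 = 0.\<close>
definition canonical_cubic_basis :: "real^4^4" where
  "canonical_cubic_basis =
     vector [vector [1/2,0,0,0], vector [0,-1/2,0,0], vector [0,0,1,0], vector [0,0,0,1]]"

definition canonical_tangent_line :: "cvec set" where
  "canonical_tangent_line = proj_line (cvec_of (canonical_cubic_basis *v cub_ds 1 0))
     (cvec_of (canonical_cubic_basis *v cub_dt 1 0))"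

lemma invertible_canonical_cubic_basis: "invertible canonical_cubic_basis"
  unfolding invertible_det_nz det_4 canonical_cubic_basis_def by simp

lemma canonical_cubic_point:
  "cmat_of canonical_cubic_basis *v cub s t = vector [s^3/2, -(s^2*t)/2, s*t^2, t^3]"
  unfolding vec_eq_4_iff
  by (simp add: matrix_vector_mult_4 cmat_of_def canonical_cubic_basis_def cub_def)

lemma canonical_tangent_directions:
  "canonical_cubic_basis *v cub_ds 1 0 = vector [3/2, 0, 0, 0]"
  "canonical_cubic_basis *v cub_dt 1 0 = vector [0, -1/2, 0, 0]"
  unfolding vec_eq_4_iff
  by (simp_all add: matrix_vector_mult_4 canonical_cubic_basis_def cub_ds_def cub_dt_def)

lemma canonical_tangent_line_eq:
  "canonical_tangent_line = proj_line (vector [3/2, 0, 0, 0]) (vector [0, -1/2, 0, 0])"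
proof -
  have "cvec_of (vector [a, b, c, d]) = vector [of_real a, of_real b, of_real c, of_real d]"
    for a b c d
    by (simp add: cvec_of_def vec_eq_4_iff)
  then show ?thesis
    by (simp add: canonical_tangent_line_def canonical_tangent_directions)
qed

lemma canonical_cubic_param:
  fixes Y :: "complex^4"
  assumes "Y$4 \<noteq> 0" "Y$1*Y$4 + Y$2*Y$3 = 0" "2*Y$2*Y$4 + Y$3^2 = 0"
  obtains s t where "t \<noteq> 0" "Y = cmat_of canonical_cubic_basis *v cub s t"
proof -
  obtain t where t: "Y$4 = t^3"
    using exists_complex_root[of 3] by auto
  with assms(1) have "t \<noteq> 0"
    by auto
  define s where "s = Y$3 / t^2"
  have Y3: "Y$3 = s * t^2"
    unfolding s_def using \<open>t \<noteq> 0\<close> by simp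
  have Y2: "Y$2 = -(s^2*t)/2"
    using assms(3) \<open>t \<noteq> 0\<close> unfolding t Y3
    by (simp add: field_simps power2_eq_square power3_eq_cube) algebra
  have Y1: "Y$1 = s^3/2"
    using assms(2) \<open>t \<noteq> 0\<close> unfolding t Y3 Y2
    by (simp add: field_simps power2_eq_square power3_eq_cube)
  show thesis
    using that[of t s] \<open>t \<noteq> 0\<close>
    by (simp add: canonical_cubic_point vec_eq_4_iff Y1 Y2 Y3 t)
qed

lemma qform_canonical:
  "qform (eps *\<^sub>R antiid4) Y = of_real eps * (2 * (Y$1*Y$4 + Y$2*Y$3))"
  "qform (eps *\<^sub>R (antiid4 ** jordan4 l)) Y =
     of_real eps * (of_real l * (2 * (Y$1*Y$4 + Y$2*Y$3)) + (2*Y$2*Y$4 + Y$3^2))"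
  unfolding qform_def sum_4
  by (simp_all add: matrix_matrix_mult_4 antiid4_def jordan4_def algebra_simps power2_eq_square)

lemma mem_canonical_QSIC_iff:
  assumes "eps \<noteq> 0"
  shows "X \<in> QSIC (eps *\<^sub>R antiid4) (eps *\<^sub>R (antiid4 ** jordan4 l)) \<longleftrightarrow>
    X \<noteq> 0 \<and> X$1*X$4 + X$2*X$3 = 0 \<and> 2*X$2*X$4 + X$3^2 = 0"
proof -
  have "complex_of_real eps \<noteq> 0"
    using assms by simp
  then have "(eps * (2 * a) = 0 \<and> eps * (m * (2 * a) + b) = 0) \<longleftrightarrow> a = 0 \<and> b = 0"
    for m a b :: complex
    by auto
  then show ?thesis
    by (simp only: QSIC_def mem_Collect_eq qform_canonical)
qed

lemma canonical_QSIC: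
  assumes "eps \<noteq> 0"
  shows "QSIC (eps *\<^sub>R antiid4) (eps *\<^sub>R (antiid4 ** jordan4 l)) =
    canonical_tangent_line \<union> twisted_cubic canonical_cubic_basis"
proof (intro equalityI subsetI)
  fix X
  assume "X \<in> QSIC (eps *\<^sub>R antiid4) (eps *\<^sub>R (antiid4 ** jordan4 l))"
  then have X: "X \<noteq> 0" "X$1*X$4 + X$2*X$3 = 0" "2*X$2*X$4 + X$3^2 = 0"
    unfolding mem_canonical_QSIC_iff[OF assms] by auto
  show "X \<in> canonical_tangent_line \<union> twisted_cubic canonical_cubic_basis"
  proof (cases "X$4 = 0")
    case True
    with X(3) have "X$3 = 0"
      by simp
    with True
    have "X = (2/3 * X$1) *s vector [3/2, 0, 0, 0] + (-2 * X$2) *s vector [0, -1/2, 0, 0]"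
      by (simp add: vec_eq_4_iff)
    then show ?thesis
      unfolding canonical_tangent_line_eq proj_line_def using X(1) by blast
  next
    case False
    then obtain s t where "t \<noteq> 0" "X = cmat_of canonical_cubic_basis *v cub s t"
      using canonical_cubic_param X(2,3) by blast
    then show ?thesis
      by (auto simp: twisted_cubic_def)
  qed
next
  fix X
  assume "X \<in> canonical_tangent_line \<union> twisted_cubic canonical_cubic_basis"
  then consider
      (line) a b where "X \<noteq> 0" "X = a *s vector [3/2, 0, 0, 0] + b *s vector [0, -1/2, 0, 0]"
    | (cubic) s t where "(s, t) \<noteq> (0, 0)" "X = vector [s^3/2, -(s^2*t)/2, s*t^2, t^3]"
    by (auto simp: canonical_tangent_line_eq proj_line_def twisted_cubic_def canonical_cubic_point)
  then show "X \<in> QSIC (eps *\<^sub>R antiid4) (eps *\<^sub>R (antiid4 ** jordan4 l))"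
  proof cases
    case line
    then show ?thesis
      unfolding mem_canonical_QSIC_iff[OF assms] by simp
  next
    case cubic
    then have "X \<noteq> 0"
      by (auto simp: vec_eq_4_iff)
    with cubic show ?thesis
      unfolding mem_canonical_QSIC_iff[OF assms]
      by (simp add: power2_eq_square power3_eq_cube algebra_simps)
  qed
qed

lemma real_line_canonical_tangent_line: "real_line canonical_tangent_line"
proof -
  define p q :: "real^4" where "p = vector [3/2, 0, 0, 0]" and "q = vector [0, -1/2, 0, 0]"
  have "p \<notin> span {q}"
  proof
    assume "p \<in> span {q}"
    then obtain k where "p = k *\<^sub>R q"
      by (auto simp: span_singleton)
    then have "p $ 1 = k * q $ 1"
      by simp
    then show False
      by (simp add: p_def q_def)
  qed
  then have "independent {p, q}"
    by (rule independent_insertI) (simp add: q_def vec_eq_4_iff)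
  moreover have "p \<noteq> q"
    by (simp add: p_def q_def vec_eq_4_iff)
  ultimately show ?thesis
    unfolding real_line_def canonical_tangent_line_def canonical_tangent_directions
      p_def[symmetric] q_def[symmetric] by blast
qed

lemma real_cubic_tangent_line_canonical:
  "real_cubic_tangent_line (twisted_cubic canonical_cubic_basis) canonical_tangent_line"
  unfolding real_cubic_tangent_line_def canonical_tangent_line_def
  using invertible_canonical_cubic_basis
  by (intro exI[of _ canonical_cubic_basis] conjI exI[of _ "1::real"] exI[of _ "0::real"]) simp_all

lemma block_sign_QSIC_line_cubic:
  assumes "block_sign A B l eps" "eps \<noteq> 0"
  shows "\<exists>L C. QSIC A B = L \<union> C \<and> real_line L \<and> real_cubic_tangent_line C L"
proof -
  obtain Q where Q: "invertible Q" and QA: "transpose Q ** A ** Q = eps *\<^sub>R antiid4"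
    and QB: "transpose Q ** B ** Q = eps *\<^sub>R (antiid4 ** jordan4 l)"
    using assms(1) unfolding block_sign_def by blast
  let ?image = "(`) ((*v) (cmat_of Q))"
  have "QSIC A B = ?image (QSIC (eps *\<^sub>R antiid4) (eps *\<^sub>R (antiid4 ** jordan4 l)))"
    using QSIC_congruence[OF Q, of A B] unfolding QA QB .
  also have "\<dots> = ?image canonical_tangent_line \<union> ?image (twisted_cubic canonical_cubic_basis)"
    unfolding canonical_QSIC[OF assms(2)] by (rule image_Un)
  finally show ?thesis
    using real_line_image[OF Q real_line_canonical_tangent_line]
      real_cubic_tangent_line_image[OF Q real_cubic_tangent_line_canonical] by blast
qed

theorem theorem12:
  fixes A B :: "real^4^4" and l0 :: real
  assumes symA: "symmetric4 A" and symB: "symmetric4 B"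
    and nonzero: "\<exists>l. pencil_det A B l \<noteq> 0"
    and quad_root: "\<exists>c. c \<noteq> 0 \<and> (\<forall>l. pencil_det A B l = c * (l - l0) ^ 4)"
    and segre: "segre_4 A B l0"
  shows "(\<forall>l<l0. Id_fun A B l = 2) \<and> (\<forall>l>l0. Id_fun A B l = 2)
         \<and> (\<exists>eps. (eps = -1 \<or> eps = 1) \<and> block_sign A B l0 eps)
         \<and> (\<exists>L C. QSIC A B = L \<union> C \<and> real_line L \<and> real_cubic_tangent_line C L)"
proof -
  obtain c where "c \<noteq> 0" and pencil: "\<And>l. pencil_det A B l = c * (l - l0) ^ 4"
    using quad_root by blast
  have "det A = c"
    by (rule det_eq_leading_coeff_pencil[of A B c l0])
      (simp add: pencil[unfolded pencil_det_def])
  then have "invertible A"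
    using \<open>c \<noteq> 0\<close> by (simp add: invertible_det_nz)
  then obtain eps where eps: "eps = -1 \<or> eps = 1" and canonical: "block_sign A B l0 eps"
    using segre_4_block_sign[OF symA symB _ segre] by blast
  have "Id_fun A B l = 2" if "l \<noteq> l0" for l
    using Id_fun_off_root[OF symA symB canonical eps _ that] pencil \<open>det A = c\<close> by simp
  moreover have "\<exists>L C. QSIC A B = L \<union> C \<and> real_line L \<and> real_cubic_tangent_line C L"
    using block_sign_QSIC_line_cubic[OF canonical] eps by auto
  ultimately show ?thesis
    using eps canonical by auto
qed

end
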